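(* Let $k,l\ge 1$ and assume that $X\subseteq\mathbb{R}^k$ is a strong $\gamma$-set. Then for each $Y\subseteq\mathbb{R}^l$, $\dim(X\times Y)=\dim(Y)$, where $\dim$ denotes Hausdorff dimension.
   Context: Hausdorff dimension: for $Z\subseteq\mathbb{R}^m$, $\dim(Z)$ is the infimum of all positive $\delta$ such that for each positive $\epsilon$ there is a cover $\{I_n\}_{n\in\mathbb{N}}$ of $Z$ with $\sum_{n}\operatorname{diam}(I_n)^\delta<\epsilon$. The product $X\times Y$ is regarded as a subset of $\mathbb{R}^{k+l}$. Strong $\gamma$-sets: let $X$ be a topological space (subsets of $\mathbb{R}^k$ carry the subspace topology). For $n\ge 1$, a cover $\mathcal{U}$ of $X$ is an $n$-cover if each $n$-element subset of $X$ is contained in some member of $\mathcal{U}$; let $\mathcal{O}_n$ be the collection of all open $n$-covers of $X$. The space $X$ is a strong $\gamma$-set if for each sequence $(\mathcal{U}_n)_{n\ge1}$ with $\mathcal{U}_n\in\mathcal{O}_n$ for each $n$, there is a sequence $(U_n)_{n\ge1}$ such that $U_n\in\mathcal{U}_n$ for each $n$, and $(U_n)_{n\ge 1}$ is a $\gamma$-cover of $X$ in the indexed sense: each $x\in X$ belongs to $U_n$ for all but finitely many $n$. *)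

theory Defs
  imports "HOL-Analysis.Analysis"
begin

text \<open>
  \<open>diameter\<close> is only meaningful on bounded sets, so boundedness of the covering sets is explicit:
  an unbounded set has infinite diameter and cannot occur in a cover with finite sum.  The value
  is an \<open>ereal\<close>, so that the infimum is always the genuine one.
\<close>

definition hausdorff_dim :: "'a::euclidean_space set \<Rightarrow> ereal" where
  "hausdorff_dim Z = Inf {ereal \<delta> |\<delta>. \<delta> > 0 \<and>
     (\<forall>\<epsilon>>0. \<exists>I :: nat \<Rightarrow> 'a set.
        Z \<subseteq> (\<Union>n. I n) \<and> (\<forall>n. bounded (I n)) \<and>
        summable (\<lambda>n. diameter (I n) powr \<delta>) \<and> (\<Sum>n. diameter (I n) powr \<delta>) < \<epsilon>)}"

definition open_n_covers :: "'a topology \<Rightarrow> nat \<Rightarrow> 'a set set set" where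
  "open_n_covers T n = {\<U>. (\<forall>U\<in>\<U>. openin T U) \<and> \<Union>\<U> = topspace T \<and>
     (\<forall>F. F \<subseteq> topspace T \<and> finite F \<and> card F = n \<longrightarrow> (\<exists>U\<in>\<U>. F \<subseteq> U))}"

text \<open>
  The empty family is an open cover of the empty space, and nothing can be selected from it, so
  the empty space is not a strong \<open>\<gamma>\<close>-set.
\<close>

definition strong_gamma_set :: "'a topology \<Rightarrow> bool" where
  "strong_gamma_set T \<longleftrightarrow>
     (\<forall>\<U> :: nat \<Rightarrow> 'a set set. (\<forall>n\<ge>1. \<U> n \<in> open_n_covers T n) \<longrightarrow>
        (\<exists>U :: nat \<Rightarrow> 'a set. (\<forall>n\<ge>1. U n \<in> \<U> n) \<and>
           (\<forall>x\<in>topspace T. \<forall>\<^sub>F n in sequentially. x \<in> U n)))"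

text \<open>
  Coordinates of \<open>\<real>\<^sup>k\<^sup>+\<^sup>l\<close> are indexed by the disjoint sum of the two index types.
\<close>

definition vec_join :: "real ^ 'k \<Rightarrow> real ^ 'l \<Rightarrow> real ^ ('k + 'l)" where
  "vec_join x y = (\<chi> i. case i of Inl a \<Rightarrow> x $ a | Inr b \<Rightarrow> y $ b)"

definition vec_Times :: "(real ^ 'k) set \<Rightarrow> (real ^ 'l) set \<Rightarrow> (real ^ ('k + 'l)) set" where
  "vec_Times X Y = (\<lambda>(x, y). vec_join x y) ` (X \<times> Y)"

end

theory Submission
  imports Defs
begin

text \<open>
  The exponents \<open>\<delta> > 0\<close> admitted in the definition of \<open>dim Z\<close> are those for which \<open>Z\<close> has
  \<open>\<delta>\<close>-dimensional Hausdorff content \<open>0\<close>.  Hence it is enough that, for every single \<open>\<delta> > 0\<close>, the product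
  \<open>X \<times> Y\<close> is a null set for the \<open>\<delta>\<close>-dimensional content if and only if \<open>Y\<close> is.  If \<open>X \<times> Y\<close> is
  null then so is \<open>Y\<close>, because \<open>X\<close> has a point and \<open>X \<times> Y\<close> then contains an isometric copy of \<open>Y\<close>
  (\<open>hausdorff_content_section_le\<close>).

  For the other direction let \<open>Y\<close> be null and \<open>\<epsilon> > 0\<close>.  Cover \<open>Y\<close> by finite families \<open>\<B> n\<close> of bounded
  sets such that each point of \<open>Y\<close> is covered by infinitely many of them, and such that the sum
  of \<open>diameter J powr \<delta>\<close> over \<open>J \<in> \<B> n\<close> is less than \<open>\<epsilon> / (n 2^n)\<close>
  (\<open>null_set_finite_families_infinitely_often\<close>).  Multiplying the finitely many members of \<open>\<B> n\<close> by a
  ball of sufficiently small radius hardly changes these sums.  Therefore any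
  \<open>n\<close> points of \<open>X\<close> have an open neighbourhood \<open>U\<close> in \<open>X\<close>, cut out by \<open>n\<close> such balls, for which
  \<open>U \<times> \<Union>(\<B> n)\<close> has content at most \<open>\<epsilon> / 2^n\<close>.  So the open sets \<open>U\<close> with this property form an
  \<open>n\<close>-cover of \<open>X\<close> (\<open>open_n_cover_of_small_content\<close>), and the strong \<open>\<gamma>\<close>-property selects one such
  \<open>U n\<close> for each \<open>n\<close> so that every \<open>x \<in> X\<close> lies in almost all of them.  Since every \<open>y \<in> Y\<close> lies in
  infinitely many of the sets \<open>\<Union>(\<B> n)\<close>, the sets \<open>U n \<times> \<Union>(\<B> n)\<close> cover \<open>X \<times> Y\<close>, and countable
  subadditivity bounds the content of \<open>X \<times> Y\<close> by \<open>\<epsilon>\<close>.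
\<close>

section \<open>Hausdorff content\<close>

text \<open>
  The values are extended non-negative reals, so that a divergent sum counts as \<open>\<infinity>\<close> and
  countable subadditivity needs no summability conditions.
\<close>

definition hausdorff_content :: "real \<Rightarrow> 'a::euclidean_space set \<Rightarrow> ennreal" where
  "hausdorff_content \<delta> Z =
     (INF I \<in> {I :: nat \<Rightarrow> 'a set. Z \<subseteq> (\<Union>n. I n) \<and> (\<forall>n. bounded (I n))}.
        \<Sum>n. ennreal (diameter (I n) powr \<delta>))"

lemma hausdorff_content_le:
  assumes "Z \<subseteq> (\<Union>n. I n)" "\<And>n. bounded (I n)"
  shows "hausdorff_content \<delta> Z \<le> (\<Sum>n. ennreal (diameter (I n) powr \<delta>))"
  unfolding hausdorff_content_def using assms by (intro INF_lower) auto

lemma hausdorff_content_lessE: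
  assumes "hausdorff_content \<delta> Z < e"
  obtains I where "Z \<subseteq> (\<Union>n. I n)" "\<And>n. bounded (I n)"
    "(\<Sum>n. ennreal (diameter (I n) powr \<delta>)) < e"
  using assms unfolding hausdorff_content_def INF_less_iff by auto

lemma suminf_ennreal_less_iff:
  fixes f :: "nat \<Rightarrow> real"
  assumes "\<And>n. 0 \<le> f n"
  shows "(\<Sum>n. ennreal (f n)) < ennreal e \<longleftrightarrow> summable f \<and> (\<Sum>n. f n) < e"
proof
  assume less: "(\<Sum>n. ennreal (f n)) < ennreal e"
  then have "summable f"
    by (intro summable_suminf_not_top assms) auto
  with less show "summable f \<and> (\<Sum>n. f n) < e"
    by (simp add: suminf_ennreal2 assms ennreal_less_iff suminf_nonneg)
next
  assume "summable f \<and> (\<Sum>n. f n) < e"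
  then show "(\<Sum>n. ennreal (f n)) < ennreal e"
    by (simp add: suminf_ennreal2 assms ennreal_less_iff suminf_nonneg)
qed

lemma ennreal_eq_0I:
  fixes x :: ennreal
  assumes "\<And>\<epsilon>. \<epsilon> > 0 \<Longrightarrow> x \<le> ennreal \<epsilon>"
  shows "x = 0"
proof -
  have "x \<le> 0"
  proof (rule ennreal_le_epsilon)
    show "x \<le> 0 + ennreal e" if "e > 0" for e
      unfolding add_0_left using that by (rule assms)
  qed
  then show ?thesis
    by simp
qed

lemma hausdorff_content_eq_0_iff:
  "hausdorff_content \<delta> Z = 0 \<longleftrightarrow>
     (\<forall>\<epsilon>>0. \<exists>I. Z \<subseteq> (\<Union>n. I n) \<and> (\<forall>n. bounded (I n)) \<and>
        summable (\<lambda>n. diameter (I n) powr \<delta>) \<and> (\<Sum>n. diameter (I n) powr \<delta>) < \<epsilon>)"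
  (is "_ \<longleftrightarrow> (\<forall>\<epsilon>>0. ?cov \<epsilon>)")
proof
  assume zero: "hausdorff_content \<delta> Z = 0"
  show "\<forall>\<epsilon>>0. ?cov \<epsilon>"
  proof (intro allI impI)
    fix \<epsilon> :: real assume "\<epsilon> > 0"
    with zero have "hausdorff_content \<delta> Z < ennreal \<epsilon>"
      by simp
    then obtain I where "Z \<subseteq> (\<Union>n. I n)" "\<And>n. bounded (I n)"
      "(\<Sum>n. ennreal (diameter (I n) powr \<delta>)) < ennreal \<epsilon>"
      by (rule hausdorff_content_lessE) blast
    then show "?cov \<epsilon>"
      by (subst (asm) suminf_ennreal_less_iff) auto
  qed
next
  assume cov: "\<forall>\<epsilon>>0. ?cov \<epsilon>"
  have "hausdorff_content \<delta> Z \<le> ennreal \<epsilon>" if "\<epsilon> > 0" for \<epsilon>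
  proof -
    obtain I where I: "Z \<subseteq> (\<Union>n. I n)" "\<And>n. bounded (I n)"
      and "summable (\<lambda>n. diameter (I n) powr \<delta>)" "(\<Sum>n. diameter (I n) powr \<delta>) < \<epsilon>"
      using cov[rule_format, OF \<open>\<epsilon> > 0\<close>] by auto
    then have "(\<Sum>n. ennreal (diameter (I n) powr \<delta>)) < ennreal \<epsilon>"
      by (subst suminf_ennreal_less_iff) auto
    with hausdorff_content_le[OF I, of \<delta>] have "hausdorff_content \<delta> Z < ennreal \<epsilon>"
      by (rule le_less_trans)
    then show ?thesis
      by (rule less_imp_le)
  qed
  then show "hausdorff_content \<delta> Z = 0"
    by (rule ennreal_eq_0I)
qed

lemma hausdorff_dim_eq_Inf_content:
  "hausdorff_dim Z = Inf {ereal \<delta> |\<delta>. \<delta> > 0 \<and> hausdorff_content \<delta> Z = 0}"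
  unfolding hausdorff_dim_def hausdorff_content_eq_0_iff ..

lemma hausdorff_content_mono:
  assumes "A \<subseteq> B"
  shows "hausdorff_content \<delta> A \<le> hausdorff_content \<delta> B"
  unfolding hausdorff_content_def using assms by (intro INF_superset_mono) auto

lemma hausdorff_content_bounded:
  assumes "bounded A"
  shows "hausdorff_content \<delta> A \<le> ennreal (diameter A powr \<delta>)"
proof -
  have "hausdorff_content \<delta> A \<le> (\<Sum>n. ennreal (diameter (binaryset A {} n) powr \<delta>))"
    using assms by (intro hausdorff_content_le) (auto simp: UN_binaryset_eq binaryset_def)
  also have "\<dots> = ennreal (diameter A powr \<delta>)"
    by (subst suminf_binaryset_eq[where f = "\<lambda>S. ennreal (diameter S powr \<delta>)"]) auto
  finally show ?thesis .
qed

lemma hausdorff_content_empty [simp]: "hausdorff_content \<delta> {} = 0"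
  using hausdorff_content_bounded[of "{}" \<delta>] by simp

lemma suminf_ennreal_half_powers:
  assumes "0 \<le> e"
  shows "(\<Sum>n. ennreal (e * (1/2) ^ Suc n)) = ennreal e"
proof (rule suminf_ennreal_eq)
  show "0 \<le> e * (1/2) ^ Suc n" for n
    using assms by (intro mult_nonneg_nonneg zero_le_power) auto
  show "(\<lambda>n. e * (1/2) ^ Suc n) sums e"
    using sums_mult[OF power_half_series, of e] unfolding mult_1_right .
qed

text \<open>
  Near-optimal covers of the sets \<open>A n\<close>, with errors summing to \<open>e\<close>, are merged into a single sequence
  along the pairing function on the natural numbers.
\<close>

lemma hausdorff_content_UN_nat:
  fixes A :: "nat \<Rightarrow> 'a::euclidean_space set"
  shows "hausdorff_content \<delta> (\<Union>n. A n) \<le> (\<Sum>n. hausdorff_content \<delta> (A n))"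
proof (rule ennreal_le_epsilon)
  fix e :: real
  assume fin: "(\<Sum>n. hausdorff_content \<delta> (A n)) < top" and "0 < e"
  have "\<exists>I. A n \<subseteq> (\<Union>m. I m) \<and> (\<forall>m. bounded (I m)) \<and>
    (\<Sum>m. ennreal (diameter (I m) powr \<delta>)) < hausdorff_content \<delta> (A n) + ennreal (e * (1/2) ^ Suc n)"
    for n
  proof -
    have "hausdorff_content \<delta> (A n) \<noteq> top"
      using fin ennreal_suminf_lessD[OF fin, of n] by auto
    then have "hausdorff_content \<delta> (A n) < hausdorff_content \<delta> (A n) + ennreal (e * (1/2) ^ Suc n)"
      using \<open>0 < e\<close> ennreal_add_left_cancel_less[of "hausdorff_content \<delta> (A n)" 0]
      by (simp add: top.not_eq_extremum)
    then show ?thesis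
      by (elim hausdorff_content_lessE) blast
  qed
  then obtain I where I: "\<And>n. A n \<subseteq> (\<Union>m. I n m)" "\<And>n m. bounded (I n m)"
    "\<And>n. (\<Sum>m. ennreal (diameter (I n m) powr \<delta>))
       < hausdorff_content \<delta> (A n) + ennreal (e * (1/2) ^ Suc n)"
    by metis
  define J where "J i = (case prod_decode i of (n, m) \<Rightarrow> I n m)" for i
  have "hausdorff_content \<delta> (\<Union>n. A n) \<le> (\<Sum>i. ennreal (diameter (J i) powr \<delta>))"
  proof (rule hausdorff_content_le)
    show "(\<Union>n. A n) \<subseteq> (\<Union>i. J i)"
    proof
      fix z assume "z \<in> (\<Union>n. A n)"
      then obtain n m where "z \<in> I n m"
        using I(1) by blast
      then have "z \<in> J (prod_encode (n, m))"
        by (simp add: J_def)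
      then show "z \<in> (\<Union>i. J i)"
        by blast
    qed
  qed (auto simp: J_def I(2) split: prod.split)
  also have "\<dots> = (\<Sum>n. \<Sum>m. ennreal (diameter (I n m) powr \<delta>))"
    using suminf_ennreal_2dimen[of "\<lambda>n. \<Sum>m. ennreal (diameter (I n m) powr \<delta>)"
        "\<lambda>p. ennreal (diameter (I (fst p) (snd p)) powr \<delta>)"]
    unfolding J_def case_prod_unfold fst_conv snd_conv by blast
  also have "\<dots> \<le> (\<Sum>n. hausdorff_content \<delta> (A n) + ennreal (e * (1/2) ^ Suc n))"
    by (rule suminf_le[OF less_imp_le[OF I(3)] summableI summableI])
  also have "\<dots> = (\<Sum>n. hausdorff_content \<delta> (A n)) + (\<Sum>n. ennreal (e * (1/2) ^ Suc n))"
    by (rule suminf_add[OF summableI summableI, symmetric])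
  also have "(\<Sum>n. ennreal (e * (1/2) ^ Suc n)) = ennreal e"
    using \<open>0 < e\<close> by (intro suminf_ennreal_half_powers) simp
  finally show "hausdorff_content \<delta> (\<Union>n. A n) \<le> (\<Sum>n. hausdorff_content \<delta> (A n)) + ennreal e" .
qed

lemma hausdorff_content_Un:
  "hausdorff_content \<delta> (A \<union> B) \<le> hausdorff_content \<delta> A + hausdorff_content \<delta> B"
  using hausdorff_content_UN_nat[of \<delta> "binaryset A B"]
  by (simp add: UN_binaryset_eq suminf_binaryset_eq)

lemma hausdorff_content_UN_finite:
  assumes "finite F"
  shows "hausdorff_content \<delta> (\<Union>i\<in>F. A i) \<le> (\<Sum>i\<in>F. hausdorff_content \<delta> (A i))"
  using assms
proof (induction F)
  case (insert i F)
  have "hausdorff_content \<delta> (A i \<union> (\<Union>i\<in>F. A i))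
      \<le> hausdorff_content \<delta> (A i) + hausdorff_content \<delta> (\<Union>i\<in>F. A i)"
    by (rule hausdorff_content_Un)
  also have "\<dots> \<le> hausdorff_content \<delta> (A i) + (\<Sum>i\<in>F. hausdorff_content \<delta> (A i))"
    using insert.IH by (rule add_left_mono)
  finally show ?case
    using insert.hyps by simp
qed simp

section \<open>Covering a null set infinitely often by small finite families\<close>

text \<open>
  A single cover \<open>I\<close> of total size below \<open>\<eta> 0\<close> is split into finite blocks of consecutive members.  Block \<open>p > 0\<close>
  starts so late that the whole remaining tail of the series is below \<open>\<eta> p\<close>; thus the blocks obey
  arbitrary prescribed bounds although the series itself may converge very slowly.
\<close>

lemma null_set_finite_families:
  fixes Y :: "'a::euclidean_space set" and \<eta> :: "nat \<Rightarrow> real"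
  assumes null: "hausdorff_content \<delta> Y = 0" and \<eta>: "\<And>p. \<eta> p > 0"
  obtains \<B> :: "nat \<Rightarrow> 'a set set" where
    "\<And>p. finite (\<B> p)" "\<And>p J. J \<in> \<B> p \<Longrightarrow> bounded J"
    "\<And>p. (\<Sum>J\<in>\<B> p. diameter J powr \<delta>) < \<eta> p" "Y \<subseteq> (\<Union>p. \<Union>(\<B> p))"
proof -
  obtain I where I: "Y \<subseteq> (\<Union>n. I n)" "\<And>n. bounded (I n)"
    and sm: "summable (\<lambda>n. diameter (I n) powr \<delta>)"
    and tot: "(\<Sum>n. diameter (I n) powr \<delta>) < \<eta> 0"
    using null \<eta>[of 0] unfolding hausdorff_content_eq_0_iff by blast
  define f where "f n = diameter (I n) powr \<delta>" for n
  have "\<exists>N\<ge>p. (p = 0 \<longrightarrow> N = 0) \<and> (\<Sum>n. f (n + N)) < \<eta> p" for p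
  proof (cases "p = 0")
    case True
    then show ?thesis
      using tot by (auto simp: f_def)
  next
    case False
    have "summable f"
      using sm by (simp add: f_def[abs_def])
    then obtain N where "\<forall>n\<ge>N. norm (\<Sum>i. f (i + n)) < \<eta> p"
      using suminf_exist_split[of "\<eta> p" f] \<eta>[of p] by blast
    then have "norm (\<Sum>i. f (i + max N p)) < \<eta> p"
      by simp
    then show ?thesis
      using False by (intro exI[of _ "max N p"]) auto
  qed
  then obtain T where T: "\<And>p. p \<le> T p" "T 0 = 0" "\<And>p. (\<Sum>n. f (n + T p)) < \<eta> p"
    by metis
  define \<B> where "\<B> p = I ` {T p..<T (Suc p)}" for p
  show ?thesis
  proof
    show "finite (\<B> p)" for p
      by (simp add: \<B>_def)
    show "bounded J" if "J \<in> \<B> p" for p J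
      using that I(2) by (auto simp: \<B>_def)
    show "(\<Sum>J\<in>\<B> p. diameter J powr \<delta>) < \<eta> p" for p
    proof -
      have "(\<Sum>J\<in>\<B> p. diameter J powr \<delta>) \<le> (\<Sum>j\<in>{T p..<T (Suc p)}. f j)"
        unfolding \<B>_def f_def
        using sum_image_le[of "{T p..<T (Suc p)}" "\<lambda>J. diameter J powr \<delta>" I] by (simp add: o_def)
      also have "\<dots> = (\<Sum>i<T (Suc p) - T p. f (i + T p))"
        by (rule sum.reindex_bij_witness[of _ "\<lambda>i. i + T p" "\<lambda>j. j - T p"]) auto
      also have "\<dots> \<le> (\<Sum>i. f (i + T p))"
        using sm by (intro sum_le_suminf summable_ignore_initial_segment) (auto simp: f_def)
      also have "\<dots> < \<eta> p"
        by (rule T(3))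
      finally show ?thesis .
    qed
    show "Y \<subseteq> (\<Union>p. \<Union>(\<B> p))"
    proof
      fix y assume "y \<in> Y"
      then obtain j where j: "y \<in> I j"
        using I(1) by blast
      \<comment> \<open>By minimality \<open>j\<close> is not below \<open>T p\<close>, either because \<open>T p\<close> was the previous candidate or
        because \<open>T 0 = 0\<close>.\<close>
      define p where "p = (LEAST p. j < T (Suc p))"
      have less: "j < T (Suc p)"
        unfolding p_def by (rule LeastI[of _ j]) (use T(1)[of "Suc j"] in simp)
      have "T p \<le> j"
      proof (cases p)
        case (Suc q)
        then have "\<not> j < T (Suc q)"
          using not_less_Least[of q "\<lambda>p. j < T (Suc p)"] by (simp add: p_def)
        then show ?thesis
          using Suc by simp
      qed (simp add: T(2))
      with less j have "I j \<in> \<B> p"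
        by (simp add: \<B>_def)
      with j show "y \<in> (\<Union>p. \<Union>(\<B> p))"
        by blast
    qed
  qed
qed

text \<open>
  Infinitely many covers of \<open>Y\<close> are interleaved: the \<open>p\<close>-th block of the \<open>m\<close>-th cover becomes family number
  \<open>prod_encode (m, p)\<close>.  A point is met by some block of every cover \<open>m\<close>, and that block has number at
  least \<open>m\<close>.
\<close>

lemma null_set_finite_families_infinitely_often:
  fixes Y :: "'a::euclidean_space set" and \<eta> :: "nat \<Rightarrow> real"
  assumes null: "hausdorff_content \<delta> Y = 0" and \<eta>: "\<And>n. \<eta> n > 0"
  obtains \<B> :: "nat \<Rightarrow> 'a set set" where
    "\<And>n. finite (\<B> n)" "\<And>n J. J \<in> \<B> n \<Longrightarrow> bounded J"
    "\<And>n. (\<Sum>J\<in>\<B> n. diameter J powr \<delta>) < \<eta> n"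
    "\<And>y. y \<in> Y \<Longrightarrow> \<exists>\<^sub>\<infinity>n. y \<in> \<Union>(\<B> n)"
proof -
  have "\<exists>\<B> :: nat \<Rightarrow> 'a set set. (\<forall>p. finite (\<B> p) \<and> (\<forall>J\<in>\<B> p. bounded J) \<and>
      (\<Sum>J\<in>\<B> p. diameter J powr \<delta>) < \<eta> (prod_encode (m, p))) \<and> Y \<subseteq> (\<Union>p. \<Union>(\<B> p))" for m
    by (rule null_set_finite_families[OF null, of "\<lambda>p. \<eta> (prod_encode (m, p))"]) (use \<eta> in blast)+
  then obtain \<B> :: "nat \<Rightarrow> nat \<Rightarrow> 'a set set" where \<B>:
    "\<And>m p. finite (\<B> m p)" "\<And>m p J. J \<in> \<B> m p \<Longrightarrow> bounded J"
    "\<And>m p. (\<Sum>J\<in>\<B> m p. diameter J powr \<delta>) < \<eta> (prod_encode (m, p))"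
    "\<And>m. Y \<subseteq> (\<Union>p. \<Union>(\<B> m p))"
    by metis
  show ?thesis
  proof
    show "finite (case prod_decode n of (m, p) \<Rightarrow> \<B> m p)" for n
      by (simp add: \<B>(1) split: prod.split)
    show "bounded J" if "J \<in> (case prod_decode n of (m, p) \<Rightarrow> \<B> m p)" for n J
      using that \<B>(2) by (auto split: prod.splits)
    show "(\<Sum>J\<in>(case prod_decode n of (m, p) \<Rightarrow> \<B> m p). diameter J powr \<delta>) < \<eta> n" for n
      using \<B>(3)[of "fst (prod_decode n)" "snd (prod_decode n)"]
      by (simp add: case_prod_unfold)
    show "\<exists>\<^sub>\<infinity>n. y \<in> \<Union>(case prod_decode n of (m, p) \<Rightarrow> \<B> m p)" if y: "y \<in> Y" for y
      unfolding INFM_nat_le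
    proof
      fix m
      obtain p where "y \<in> \<Union>(\<B> m p)"
        using \<B>(4)[of m] y by blast
      then show "\<exists>n\<ge>m. y \<in> \<Union>(case prod_decode n of (m, p) \<Rightarrow> \<B> m p)"
        by (intro exI[of _ "prod_encode (m, p)"]) (simp add: le_prod_encode_1)
    qed
  qed
qed

section \<open>Products\<close>

lemma dist_vec_join:
  "dist (vec_join x y) (vec_join x' y') = sqrt ((dist x x')\<^sup>2 + (dist y y')\<^sup>2)"
  by (simp add: dist_vec_def L2_set_def vec_join_def UNIV_Plus_UNIV[symmetric]
      sum.Plus sum_nonneg del: UNIV_Plus_UNIV)

lemma dist_vec_join_le:
  "dist (vec_join x y) (vec_join x' y') \<le> dist x x' + dist y y'"
  unfolding dist_vec_join by (rule sqrt_sum_squares_le_sum) auto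

lemma bounded_diameter_vec_Times_ball:
  assumes "bounded J" and "\<rho> > 0"
  shows "bounded (vec_Times (ball x \<rho>) J)"
    and "diameter (vec_Times (ball x \<rho>) J) \<le> 2 * \<rho> + diameter J"
proof -
  have dist: "dist z z' \<le> 2 * \<rho> + diameter J"
    if zz: "z \<in> vec_Times (ball x \<rho>) J" "z' \<in> vec_Times (ball x \<rho>) J" for z z'
  proof -
    obtain u y u' y' where eq: "z = vec_join u y" "z' = vec_join u' y'"
      and mem: "u \<in> ball x \<rho>" "u' \<in> ball x \<rho>" "y \<in> J" "y' \<in> J"
      using zz by (auto simp: vec_Times_def)
    have "dist u u' \<le> dist x u + dist x u'"
      using dist_triangle3 by (metis dist_commute)
    moreover have "dist y y' \<le> diameter J"
      using mem assms(1) by (intro diameter_bounded_bound)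
    ultimately show ?thesis
      using mem dist_vec_join_le[of u y u' y'] by (simp add: eq)
  qed
  then show "bounded (vec_Times (ball x \<rho>) J)"
    unfolding bounded_two_points by blast
  show "diameter (vec_Times (ball x \<rho>) J) \<le> 2 * \<rho> + diameter J"
    using assms diameter_ge_0[OF assms(1)] dist
    by (intro diameter_le) (auto simp flip: dist_norm)
qed

lemma vec_Times_UN_left: "vec_Times (\<Union>i\<in>F. A i) K = (\<Union>i\<in>F. vec_Times (A i) K)"
  by (auto simp: vec_Times_def)

lemma vec_Times_Union_right: "vec_Times A (\<Union>\<B>) = (\<Union>J\<in>\<B>. vec_Times A J)"
  by (auto simp: vec_Times_def)

lemma vec_Times_mono: "A \<subseteq> A' \<Longrightarrow> B \<subseteq> B' \<Longrightarrow> vec_Times A B \<subseteq> vec_Times A' B'"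
  by (auto simp: vec_Times_def)

text \<open>
  The slice map \<open>y \<mapsto> vec_join x y\<close> is an isometry, so it pulls covers of \<open>X \<times> Y\<close> back to covers of \<open>Y\<close>
  without increasing diameters.
\<close>

lemma hausdorff_content_section_le:
  fixes X :: "(real ^ 'k) set" and Y :: "(real ^ 'l) set"
  assumes "x \<in> X" and "\<delta> > 0"
  shows "hausdorff_content \<delta> Y \<le> hausdorff_content \<delta> (vec_Times X Y)"
  unfolding hausdorff_content_def[of \<delta> "vec_Times X Y"]
proof (rule INF_greatest)
  fix I :: "nat \<Rightarrow> (real ^ ('k + 'l)) set"
  assume "I \<in> {I. vec_Times X Y \<subseteq> (\<Union>n. I n) \<and> (\<forall>n. bounded (I n))}"
  then have I: "vec_Times X Y \<subseteq> (\<Union>n. I n)" "\<And>n. bounded (I n)"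
    by auto
  define J where "J n = vec_join x -` I n" for n
  have dist: "dist y y' \<le> diameter (I n)" if "y \<in> J n" "y' \<in> J n" for n y y'
    using that diameter_bounded_bound[OF I(2)[of n], of "vec_join x y" "vec_join x y'"]
    by (simp add: J_def dist_vec_join)
  have bdd: "bounded (J n)" for n
    unfolding bounded_two_points using dist by blast
  have diam: "diameter (J n) \<le> diameter (I n)" for n
    using diameter_ge_0[OF I(2)] dist by (intro diameter_le) (auto simp flip: dist_norm)
  have "hausdorff_content \<delta> Y \<le> (\<Sum>n. ennreal (diameter (J n) powr \<delta>))"
  proof (rule hausdorff_content_le)
    show "Y \<subseteq> (\<Union>n. J n)"
      using I(1) \<open>x \<in> X\<close> by (fastforce simp: J_def vec_Times_def)
  qed (rule bdd)
  also have "\<dots> \<le> (\<Sum>n. ennreal (diameter (I n) powr \<delta>))"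
    using diam diameter_ge_0[OF bdd] \<open>\<delta> > 0\<close>
    by (intro suminf_le ennreal_leI powr_mono2) auto
  finally show "hausdorff_content \<delta> Y \<le> (\<Sum>n. ennreal (diameter (I n) powr \<delta>))" .
qed

text \<open>
  The product of \<open>J\<close> with a ball of radius \<open>\<rho>\<close> has diameter at most \<open>2 * \<rho> + diameter J\<close>.  As \<open>\<B>\<close> is finite
  and \<open>\<delta> > 0\<close>, the resulting sum depends continuously on \<open>\<rho>\<close> down to \<open>\<rho> = 0\<close>, so a strict bound
  for \<open>\<B>\<close> survives for some positive \<open>\<rho>\<close>, uniformly in the centre of the ball.
\<close>

lemma hausdorff_content_thin_slab:
  fixes \<B> :: "(real ^ 'l) set set"
  assumes "finite \<B>" and bdd: "\<And>J. J \<in> \<B> \<Longrightarrow> bounded J" and "\<delta> > 0"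
    and less: "(\<Sum>J\<in>\<B>. diameter J powr \<delta>) < t"
  obtains \<rho> where "\<rho> > 0"
    "\<And>x :: real ^ 'k. hausdorff_content \<delta> (vec_Times (ball x \<rho>) (\<Union>\<B>)) \<le> ennreal t"
proof -
  have "((\<lambda>\<rho>. \<Sum>J\<in>\<B>. (2 * \<rho> + diameter J) powr \<delta>) \<longlongrightarrow> (\<Sum>J\<in>\<B>. (2 * 0 + diameter J) powr \<delta>))
      (at_right 0)"
    using \<open>\<delta> > 0\<close> diameter_ge_0 bdd
    by (intro tendsto_sum tendsto_powr' tendsto_intros)
      (auto intro!: eventually_at_rightI[of 0 1])
  then have "\<forall>\<^sub>F \<rho> in at_right 0. (\<Sum>J\<in>\<B>. (2 * \<rho> + diameter J) powr \<delta>) < t"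
    by (rule order_tendstoD) (simp add: less)
  then have "\<forall>\<^sub>F \<rho> in at_right 0. \<rho> > 0 \<and> (\<Sum>J\<in>\<B>. (2 * \<rho> + diameter J) powr \<delta>) < t"
    using eventually_at_right_less[of "0 :: real"] by eventually_elim simp
  then obtain \<rho> where \<rho>: "\<rho> > 0" "(\<Sum>J\<in>\<B>. (2 * \<rho> + diameter J) powr \<delta>) < t"
    using eventually_happens' trivial_limit_at_right_real by blast
  show ?thesis
  proof
    fix x :: "real ^ 'k"
    have "hausdorff_content \<delta> (vec_Times (ball x \<rho>) (\<Union>\<B>))
        \<le> (\<Sum>J\<in>\<B>. hausdorff_content \<delta> (vec_Times (ball x \<rho>) J))"
      unfolding vec_Times_Union_right using \<open>finite \<B>\<close> by (rule hausdorff_content_UN_finite)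
    also have "\<dots> \<le> (\<Sum>J\<in>\<B>. ennreal ((2 * \<rho> + diameter J) powr \<delta>))"
    proof (rule sum_mono)
      fix J assume "J \<in> \<B>"
      note slab = bounded_diameter_vec_Times_ball[OF bdd[OF this] \<rho>(1), of x]
      have "hausdorff_content \<delta> (vec_Times (ball x \<rho>) J)
          \<le> ennreal (diameter (vec_Times (ball x \<rho>) J) powr \<delta>)"
        using slab(1) by (rule hausdorff_content_bounded)
      also have "\<dots> \<le> ennreal ((2 * \<rho> + diameter J) powr \<delta>)"
        using slab(2) diameter_ge_0[OF slab(1)] \<open>\<delta> > 0\<close> by (intro ennreal_leI powr_mono2) auto
      finally show "hausdorff_content \<delta> (vec_Times (ball x \<rho>) J)
          \<le> ennreal ((2 * \<rho> + diameter J) powr \<delta>)" .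
    qed
    also have "\<dots> \<le> ennreal t"
      using \<rho>(2) by (subst sum_ennreal) (auto intro: ennreal_leI)
    finally show "hausdorff_content \<delta> (vec_Times (ball x \<rho>) (\<Union>\<B>)) \<le> ennreal t" .
  qed (rule \<rho>(1))
qed

section \<open>Strong \<open>\<gamma>\<close>-sets\<close>

text \<open>
  On the empty space the empty family is an \<open>n\<close>-cover for every \<open>n \<ge> 1\<close>, but it offers nothing to select.
\<close>

lemma strong_gamma_set_nonempty:
  assumes "strong_gamma_set T"
  shows "topspace T \<noteq> {}"
proof
  assume "topspace T = {}"
  then have e: "\<forall>n\<ge>1. {} \<in> open_n_covers T n"
    by (auto simp: open_n_covers_def)
  have "\<exists>U :: nat \<Rightarrow> 'a set. \<forall>n\<ge>1. U n \<in> {}"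
    using assms[unfolded strong_gamma_set_def, rule_format, of "\<lambda>_. {}"] e by blast
  then show False
    by auto
qed

text \<open>
  This is where the index \<open>n\<close> of the cover matters: \<open>n\<close> points need \<open>n\<close> balls, and each of these
  costs at most \<open>t / n\<close>.
\<close>

lemma open_n_cover_of_small_content:
  fixes X :: "(real ^ 'k) set" and \<B> :: "(real ^ 'l) set set"
  assumes "finite \<B>" "\<And>J. J \<in> \<B> \<Longrightarrow> bounded J" "\<delta> > 0"
    and less: "(\<Sum>J\<in>\<B>. diameter J powr \<delta>) < t / real n" and "n \<ge> 1"
  shows "{U. openin (top_of_set X) U \<and> hausdorff_content \<delta> (vec_Times U (\<Union>\<B>)) \<le> ennreal t}
           \<in> open_n_covers (top_of_set X) n" (is "?\<U> \<in> _")
proof -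
  obtain \<rho> where \<rho>: "\<rho> > 0" and slab: "\<And>x :: real ^ 'k.
      hausdorff_content \<delta> (vec_Times (ball x \<rho>) (\<Union>\<B>)) \<le> ennreal (t / real n)"
    by (rule hausdorff_content_thin_slab[OF assms(1-4)]) blast+
  have "0 \<le> (\<Sum>J\<in>\<B>. diameter J powr \<delta>)"
    by (intro sum_nonneg) simp
  with less have t: "t / real n > 0"
    by linarith
  \<comment> \<open>Sets of fewer than \<open>n\<close> points are included because singletons are needed for \<open>?\<U>\<close> to cover \<open>X\<close>
    when \<open>X\<close> has fewer than \<open>n\<close> points.\<close>
  have ex: "\<exists>U\<in>?\<U>. F \<subseteq> U" if F: "F \<subseteq> X" "finite F" "card F \<le> n" for F
  proof
    define U where "U = X \<inter> (\<Union>x\<in>F. ball x \<rho>)"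
    show "F \<subseteq> U"
      using F(1) \<rho> by (auto simp: U_def)
    have "hausdorff_content \<delta> (vec_Times U (\<Union>\<B>))
        \<le> hausdorff_content \<delta> (\<Union>x\<in>F. vec_Times (ball x \<rho>) (\<Union>\<B>))"
      unfolding vec_Times_UN_left[symmetric]
      by (intro hausdorff_content_mono vec_Times_mono) (auto simp: U_def)
    also have "\<dots> \<le> (\<Sum>x\<in>F. hausdorff_content \<delta> (vec_Times (ball x \<rho>) (\<Union>\<B>)))"
      using F(2) by (rule hausdorff_content_UN_finite)
    also have "\<dots> \<le> (\<Sum>x\<in>F. ennreal (t / real n))"
      by (intro sum_mono slab)
    also have "\<dots> = ennreal (real (card F) * (t / real n))"
      by (subst ennreal_mult) (use t in \<open>simp_all add: ennreal_of_nat_eq_real_of_nat\<close>)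
    also have "\<dots> \<le> ennreal (real n * (t / real n))"
      using t F(3) by (intro ennreal_leI mult_right_mono) auto
    finally show "U \<in> ?\<U>"
      using \<open>n \<ge> 1\<close> by (auto simp: U_def intro!: openin_open_Int)
  qed
  have "x \<in> \<Union>?\<U>" if "x \<in> X" for x
    using ex[of "{x}"] that \<open>n \<ge> 1\<close> by auto
  moreover have "U \<subseteq> X" if "U \<in> ?\<U>" for U
    using that openin_imp_subset by blast
  ultimately have "\<Union>?\<U> = X"
    by blast
  then show ?thesis
    using ex by (auto simp: open_n_covers_def)
qed

lemma hausdorff_content_strong_gamma_Times:
  fixes X :: "(real ^ 'k) set" and Y :: "(real ^ 'l) set"
  assumes gamma: "strong_gamma_set (top_of_set X)"
    and null: "hausdorff_content \<delta> Y = 0" and "\<delta> > 0"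
  shows "hausdorff_content \<delta> (vec_Times X Y) = 0"
proof -
  have "hausdorff_content \<delta> (vec_Times X Y) \<le> ennreal \<epsilon>" if "\<epsilon> > 0" for \<epsilon>
  proof -
    \<comment> \<open>The cover of \<open>X \<times> Y\<close> starts at index \<open>1\<close>; \<open>max n 1\<close> keeps the bound at index \<open>0\<close> positive.\<close>
    obtain \<B> :: "nat \<Rightarrow> (real ^ 'l) set set" where \<B>:
      "\<And>n. finite (\<B> n)" "\<And>n J. J \<in> \<B> n \<Longrightarrow> bounded J"
      "\<And>n. (\<Sum>J\<in>\<B> n. diameter J powr \<delta>) < \<epsilon> * (1/2) ^ n / real (max n 1)"
      "\<And>y. y \<in> Y \<Longrightarrow> \<exists>\<^sub>\<infinity>n. y \<in> \<Union>(\<B> n)"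
      by (rule null_set_finite_families_infinitely_often[OF null,
            of "\<lambda>n. \<epsilon> * (1/2) ^ n / real (max n 1)"]) (use \<open>\<epsilon> > 0\<close> in auto)
    define \<U> where "\<U> n = {U. openin (top_of_set X) U \<and>
      hausdorff_content \<delta> (vec_Times U (\<Union>(\<B> n))) \<le> ennreal (\<epsilon> * (1/2) ^ n)}" for n
    have "\<U> n \<in> open_n_covers (top_of_set X) n" if "n \<ge> 1" for n
      unfolding \<U>_def using \<B>(3)[of n] that
      by (intro open_n_cover_of_small_content \<B>(1,2) \<open>\<delta> > 0\<close>) (auto simp: max_def)
    then obtain U where U: "\<And>n. n \<ge> 1 \<Longrightarrow> U n \<in> \<U> n"
      and ev: "\<And>x. x \<in> X \<Longrightarrow> \<forall>\<^sub>F n in sequentially. x \<in> U n"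
      using gamma unfolding strong_gamma_set_def by (metis topspace_euclidean_subtopology)
    have "vec_Times X Y \<subseteq> (\<Union>n. vec_Times (U (Suc n)) (\<Union>(\<B> (Suc n))))"
    proof
      fix z assume "z \<in> vec_Times X Y"
      then obtain x y where z: "z = vec_join x y" "x \<in> X" "y \<in> Y"
        by (auto simp: vec_Times_def)
      obtain N where N: "\<And>n. n \<ge> N \<Longrightarrow> x \<in> U n"
        using ev[OF z(2)] by (auto simp: eventually_sequentially)
      obtain n where n: "n \<ge> Suc N" "y \<in> \<Union>(\<B> n)"
        using \<B>(4)[OF z(3)] unfolding INFM_nat_le by blast
      then obtain m where "n = Suc m"
        by (cases n) auto
      with n N[of n] z(1) show "z \<in> (\<Union>n. vec_Times (U (Suc n)) (\<Union>(\<B> (Suc n))))"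
        by (auto simp: vec_Times_def intro!: exI[of _ m])
    qed
    then have "hausdorff_content \<delta> (vec_Times X Y)
        \<le> hausdorff_content \<delta> (\<Union>n. vec_Times (U (Suc n)) (\<Union>(\<B> (Suc n))))"
      by (rule hausdorff_content_mono)
    also have "\<dots> \<le> (\<Sum>n. hausdorff_content \<delta> (vec_Times (U (Suc n)) (\<Union>(\<B> (Suc n)))))"
      by (rule hausdorff_content_UN_nat)
    also have "\<dots> \<le> (\<Sum>n. ennreal (\<epsilon> * (1/2) ^ Suc n))"
    proof (intro suminf_le)
      show "hausdorff_content \<delta> (vec_Times (U (Suc n)) (\<Union>(\<B> (Suc n))))
          \<le> ennreal (\<epsilon> * (1/2) ^ Suc n)" for n
        using U[of "Suc n"] unfolding \<U>_def by simp
    qed auto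
    also have "\<dots> = ennreal \<epsilon>"
      using \<open>\<epsilon> > 0\<close> by (intro suminf_ennreal_half_powers) simp
    finally show ?thesis .
  qed
  then show ?thesis
    by (rule ennreal_eq_0I)
qed

theorem theorem8:
  fixes X :: "(real ^ 'k) set" and Y :: "(real ^ 'l) set"
  assumes "strong_gamma_set (top_of_set X)"
  shows "hausdorff_dim (vec_Times X Y) = hausdorff_dim Y"
proof -
  obtain x where "x \<in> X"
    using strong_gamma_set_nonempty[OF assms] by auto
  have "hausdorff_content \<delta> (vec_Times X Y) = 0 \<longleftrightarrow> hausdorff_content \<delta> Y = 0"
    if "\<delta> > 0" for \<delta>
    using hausdorff_content_section_le[OF \<open>x \<in> X\<close> that, of Y]
      hausdorff_content_strong_gamma_Times[OF assms _ that, of Y]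
    by auto
  then have "{ereal \<delta> |\<delta>. \<delta> > 0 \<and> hausdorff_content \<delta> (vec_Times X Y) = 0} =
      {ereal \<delta> |\<delta>. \<delta> > 0 \<and> hausdorff_content \<delta> Y = 0}"
    by blast
  then show ?thesis
    unfolding hausdorff_dim_eq_Inf_content by (rule arg_cong)
qed

end
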